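(* Let $n,d\ge 1$ and let $F\colon\mathbb{R}^d\to\mathbb{R}\cup\{+\infty\}$ have a minimizer $x_\star\in\operatorname{argmin}_{x\in\mathbb{R}^d}F(x)$ with finite optimal value $F(x_\star)$. Let $\phi\colon\mathbb{R}^d\to\mathbb{R}^d$ be a map and let $A_0\in\mathbb{R}^{n\times n}$, $B_0\in\mathbb{R}^{n\times d}$, $C_0,E_0\in\mathbb{R}^{d\times n}$. Let the sequences $\xi_k\in\mathbb{R}^n$, $u_k,y_k,x_k\in\mathbb{R}^d$ ($k\ge 0$) satisfy $$\xi_{k+1}=A_0\xi_k+B_0u_k,\quad y_k=C_0\xi_k,\quad u_k=\phi(y_k),\quad x_k=E_0\xi_k .$$ Assume there are $\xi_\star\in\mathbb{R}^n$ and $u_\star,y_\star\in\mathbb{R}^d$ with $\xi_\star=A_0\xi_\star+B_0u_\star$, $y_\star=C_0\xi_\star$, $u_\star=\phi(y_\star)$, $x_\star=E_0\xi_\star=y_\star$. Assume there are symmetric matrices $M_0^1,M_0^2,M_0^3\in\mathbb{R}^{(n+d)\times(n+d)}$ (not depending on $k$), with $M_0^3$ either zero or indefinite, such that, with $e_k=[(\xi_k-\xi_\star)^\top\ (u_k-u_\star)^\top]^\top$, for all $k\ge 0$ $$F(x_{k+1})-F(x_k)\le e_k^\top M_0^1e_k,\qquad F(x_{k+1})-F(x_\star)\le e_k^\top M_0^2e_k,\qquad 0\le e_k^\top M_0^3e_k .$$ Suppose that for some $0<\rho\le 1$ there exist $a_0>0$, a symmetric positive semidefinite $P_0\in\mathbb{R}^{n\times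 n}$, and $\lambda_0\ge 0$ satisfying $$\begin{bmatrix}A_0^\top P_0A_0-\rho^2P_0 & A_0^\top P_0B_0\\ B_0^\top P_0A_0 & B_0^\top P_0B_0\end{bmatrix}+a_0\rho^2M_0^1+a_0(1-\rho^2)M_0^2+\lambda_0M_0^3\preceq 0 .$$ Then for all $k\ge 0$ $$F(x_k)-F(x_\star)\le\frac{a_0\,(F(x_0)-F(x_\star))+(\xi_0-\xi_\star)^\top P_0(\xi_0-\xi_\star)}{a_0}\,\rho^{2k}.$$
   Context: A symmetric matrix is indefinite if it is neither positive semidefinite nor negative semidefinite. $M\preceq 0$ means that the symmetric matrix $M$ is negative semidefinite. Inequalities involving values of $F$ are read in the extended reals: $F(x_{k+1})-F(x_k)\le c$ means $F(x_{k+1})\le F(x_k)+c$. *)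

theory Defs
  imports "HOL-Analysis.Analysis"
begin

definition quad_form :: "real ^ 'm ^ 'm \<Rightarrow> real ^ 'm \<Rightarrow> real" where
  "quad_form M v = v \<bullet> (M *v v)"

definition symmetric_matrix :: "real ^ 'm ^ 'm \<Rightarrow> bool" where
  "symmetric_matrix M \<longleftrightarrow> transpose M = M"

definition pos_semidef :: "real ^ 'm ^ 'm \<Rightarrow> bool" where
  "pos_semidef M \<longleftrightarrow> symmetric_matrix M \<and> (\<forall>v. 0 \<le> quad_form M v)"

definition neg_semidef :: "real ^ 'm ^ 'm \<Rightarrow> bool" where
  "neg_semidef M \<longleftrightarrow> symmetric_matrix M \<and> (\<forall>v. quad_form M v \<le> 0)"

definition indefinite :: "real ^ 'm ^ 'm \<Rightarrow> bool" where
  "indefinite M \<longleftrightarrow> symmetric_matrix M \<and> \<not> pos_semidef M \<and> \<not> neg_semidef M"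

text \<open>The index set of size $n + d$ is the sum type: \<^const>\<open>Inl\<close> indexes the first $n$
  coordinates, \<^const>\<open>Inr\<close> the last $d$. Note that an $m \times n$ matrix has type
  \<^typ>\<open>real ^ 'n ^ 'm\<close>, with the column index first.\<close>

definition stack :: "real ^ 'n \<Rightarrow> real ^ 'd \<Rightarrow> real ^ ('n + 'd)" where
  "stack v w = (\<chi> i. case i of Inl a \<Rightarrow> v $ a | Inr b \<Rightarrow> w $ b)"

definition block_matrix ::
  "real ^ 'n ^ 'n \<Rightarrow> real ^ 'd ^ 'n \<Rightarrow> real ^ 'n ^ 'd \<Rightarrow> real ^ 'd ^ 'd
    \<Rightarrow> real ^ ('n + 'd) ^ ('n + 'd)" where
  "block_matrix P Q R S = (\<chi> i j.
     case i of
       Inl a \<Rightarrow> (case j of Inl a' \<Rightarrow> P $ a $ a' | Inr b' \<Rightarrow> Q $ a $ b')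
     | Inr b \<Rightarrow> (case j of Inl a' \<Rightarrow> R $ b $ a' | Inr b' \<Rightarrow> S $ b $ b'))"

end

theory Submission
  imports Defs
begin

text \<open>The Lyapunov function $V_k = a_0 (F(x_k) - F(x_\star)) + (\xi_k - \xi_\star)^\top P_0
  (\xi_k - \xi_\star)$ contracts by the factor $\rho^2$ in every step: evaluating the matrix
  inequality at $e_k$ bounds the change of its quadratic part, and $\rho^2$ times the first
  plus $1 - \rho^2$ times the second bound on $F(x_{k+1})$ bounds the change of the other.\<close>

lemma quad_form_add: "quad_form (A + B) v = quad_form A v + quad_form B v"
  by (simp add: quad_form_def matrix_vector_mult_add_rdistrib inner_add_right)

lemma quad_form_scaleR: "quad_form (c *\<^sub>R A) v = c * quad_form A v"
  by (simp add: quad_form_def scaleR_matrix_vector_assoc [symmetric])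

lemma sum_UNIV_sum_type:
  fixes f :: "'a::finite + 'b::finite \<Rightarrow> 'c::comm_monoid_add"
  shows "sum f UNIV = (\<Sum>a\<in>UNIV. f (Inl a)) + (\<Sum>b\<in>UNIV. f (Inr b))"
  by (simp add: UNIV_Plus_UNIV [symmetric] sum.Plus del: UNIV_Plus_UNIV)

lemma inner_stack: "stack v w \<bullet> stack v' w' = v \<bullet> v' + w \<bullet> w'"
  by (simp add: inner_vec_def sum_UNIV_sum_type stack_def)

lemma block_matrix_mult_stack:
  "block_matrix P Q R S *v stack v w = stack (P *v v + Q *v w) (R *v v + S *v w)"
  by (simp add: vec_eq_iff matrix_vector_mult_def block_matrix_def stack_def sum_UNIV_sum_type
      split: sum.split)

text \<open>The adjoint identity is phrased with \<open>v*\<close> because the simplifier turns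
  \<open>transpose A *v w\<close> into \<open>w v* A\<close>.\<close>

lemma inner_vector_matrix_mult:
  fixes A :: "real ^ 'n ^ 'm"
  shows "v \<bullet> (w v* A) = (A *v v) \<bullet> w"
  by (metis dot_lmul_matrix inner_commute)

text \<open>With [A B] denoting the horizontal concatenation, the block matrix is [A B]^T P [A B]
  with \<open>c *\<^sub>R P\<close> subtracted in the upper left corner, and [A B] sends
  \<open>stack v w\<close> to \<open>A *v v + B *v w\<close>.\<close>

lemma quad_form_block_matrix:
  fixes A :: "real ^ 'n ^ 'n" and B :: "real ^ 'd ^ 'n"
  shows "quad_form
      (block_matrix (transpose A ** P ** A - c *\<^sub>R P) (transpose A ** P ** B)
         (transpose B ** P ** A) (transpose B ** P ** B)) (stack v w)
    = quad_form P (A *v v + B *v w) - c * quad_form P v"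
  by (simp add: quad_form_def block_matrix_mult_stack inner_stack inner_vector_matrix_mult
      matrix_vector_mul_assoc [symmetric] matrix_vector_mult_diff_rdistrib
      matrix_vector_right_distrib scaleR_matrix_vector_assoc [symmetric]
      inner_add_left inner_add_right inner_diff_right)

theorem theorem3p2:
  fixes F :: "real ^ 'd \<Rightarrow> ereal"
    and \<phi> :: "real ^ 'd \<Rightarrow> real ^ 'd"
    and A0 :: "real ^ 'n ^ 'n" and B0 :: "real ^ 'd ^ 'n" and C0 E0 :: "real ^ 'n ^ 'd"
    and \<xi> :: "nat \<Rightarrow> real ^ 'n" and u y x :: "nat \<Rightarrow> real ^ 'd"
    and \<xi>_star :: "real ^ 'n" and u_star y_star x_star :: "real ^ 'd"
    and M1 M2 M3 :: "real ^ ('n + 'd) ^ ('n + 'd)"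
    and e :: "nat \<Rightarrow> real ^ ('n + 'd)"
    and \<rho> a0 lambda0 :: real and P0 :: "real ^ 'n ^ 'n"
  assumes F_not_MInf: "\<And>z. F z \<noteq> - \<infinity>"
    and minimizer: "\<And>z. F x_star \<le> F z"
    and finite_opt: "\<bar>F x_star\<bar> \<noteq> \<infinity>"
    and dyn_xi: "\<And>k. \<xi> (Suc k) = A0 *v \<xi> k + B0 *v u k"
    and dyn_y: "\<And>k. y k = C0 *v \<xi> k"
    and dyn_u: "\<And>k. u k = \<phi> (y k)"
    and dyn_x: "\<And>k. x k = E0 *v \<xi> k"
    and fix_xi: "\<xi>_star = A0 *v \<xi>_star + B0 *v u_star"
    and fix_y: "y_star = C0 *v \<xi>_star"
    and fix_u: "u_star = \<phi> y_star"
    and fix_x: "x_star = E0 *v \<xi>_star" "E0 *v \<xi>_star = y_star"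
    and sym: "symmetric_matrix M1" "symmetric_matrix M2" "symmetric_matrix M3"
    and M3: "M3 = 0 \<or> indefinite M3"
    and e_def: "\<And>k. e k = stack (\<xi> k - \<xi>_star) (u k - u_star)"
    and M1_bound: "\<And>k. F (x (Suc k)) \<le> F (x k) + ereal (quad_form M1 (e k))"
    and M2_bound: "\<And>k. F (x (Suc k)) \<le> F x_star + ereal (quad_form M2 (e k))"
    and M3_bound: "\<And>k. 0 \<le> quad_form M3 (e k)"
    and rho: "0 < \<rho>" "\<rho> \<le> 1"
    and a0: "a0 > 0"
    and P0: "pos_semidef P0"
    and lambda0: "lambda0 \<ge> 0"
    and LMI: "neg_semidef
      (block_matrix
         (transpose A0 ** P0 ** A0 - \<rho>\<^sup>2 *\<^sub>R P0) (transpose A0 ** P0 ** B0)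
         (transpose B0 ** P0 ** A0)               (transpose B0 ** P0 ** B0)
       + (a0 * \<rho>\<^sup>2) *\<^sub>R M1 + (a0 * (1 - \<rho>\<^sup>2)) *\<^sub>R M2 + lambda0 *\<^sub>R M3)"
  shows "\<forall>k. F (x k) - F x_star
    \<le> (ereal a0 * (F (x 0) - F x_star) + ereal (quad_form P0 (\<xi> 0 - \<xi>_star))) / ereal a0
        * ereal (\<rho> ^ (2 * k))"
proof
  fix k
  define q where "q = (\<lambda>k. quad_form P0 (\<xi> k - \<xi>_star))"
  obtain fs where fs: "F x_star = ereal fs"
    using finite_opt by auto
  have rho2: "0 \<le> \<rho>\<^sup>2" "0 \<le> 1 - \<rho>\<^sup>2"
    using rho by (auto simp: power_le_one)
  have q_step: "q (Suc k) - \<rho>\<^sup>2 * q k + a0 * \<rho>\<^sup>2 * quad_form M1 (e k)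
      + a0 * (1 - \<rho>\<^sup>2) * quad_form M2 (e k) \<le> 0" for k
  proof -
    have "\<xi> (Suc k) - \<xi>_star = A0 *v (\<xi> k - \<xi>_star) + B0 *v (u k - u_star)"
      \<comment> \<open>Subtracting the fixed-point equation makes the error dynamics linear. A
        single \<open>subst\<close> is used because \<open>fix_xi\<close> has
        \<open>\<xi>_star\<close> on both sides and would loop as a rewrite rule.\<close>
      by (subst fix_xi) (simp add: dyn_xi matrix_vector_mult_diff_distrib)
    moreover note LMI [unfolded neg_semidef_def, THEN conjunct2, rule_format,
        of "stack (\<xi> k - \<xi>_star) (u k - u_star)"]
    ultimately have "q (Suc k) - \<rho>\<^sup>2 * q k + a0 * \<rho>\<^sup>2 * quad_form M1 (e k)
        + a0 * (1 - \<rho>\<^sup>2) * quad_form M2 (e k) + lambda0 * quad_form M3 (e k) \<le> 0"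
      by (simp add: q_def quad_form_add quad_form_scaleR quad_form_block_matrix e_def)
    moreover have "0 \<le> lambda0 * quad_form M3 (e k)"
      using lambda0 M3_bound by simp
    ultimately show ?thesis by linarith
  qed
  show "F (x k) - F x_star
    \<le> (ereal a0 * (F (x 0) - F x_star) + ereal (quad_form P0 (\<xi> 0 - \<xi>_star))) / ereal a0
        * ereal (\<rho> ^ (2 * k))"
  \<comment> \<open>If \<open>F (x 0)\<close> is infinite, so is the right-hand side:
    \<open>\<rho> > 0\<close> excludes the product of infinity and 0, which is 0 in
    \<open>ereal\<close>.\<close>
  proof (cases "F (x 0) = \<infinity>")
    case True
    then show ?thesis
      using fs a0 rho by simp
  next
    case False
    define f where "f = (\<lambda>k. real_of_ereal (F (x k)))"
    have F_f: "F (x k) = ereal (f k)" for k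
    proof -
      \<comment> \<open>After the first step finiteness comes from \<open>M2_bound\<close>, whose
        right-hand side is finite; at index 0 it is the case assumption.\<close>
      have "F (x k) \<noteq> \<infinity>"
      proof (cases k)
        case (Suc j)
        then show ?thesis
          using M2_bound [of j] fs by auto
      qed (simp add: False)
      then show ?thesis
        using F_not_MInf [of "x k"] by (cases "F (x k)") (simp_all add: f_def)
    qed
    define V where "V = (\<lambda>k. a0 * (f k - fs) + q k)"
    have V_step: "V (Suc k) \<le> \<rho>\<^sup>2 * V k" for k
    proof -
      have "f (Suc k) \<le> f k + quad_form M1 (e k)" "f (Suc k) \<le> fs + quad_form M2 (e k)"
        using M1_bound [of k] M2_bound [of k] by (simp_all add: F_f fs)
      \<comment> \<open>The nonnegative weights sum to \<open>a0\<close>. Adding both lines and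
        subtracting \<open>a0 * fs\<close> leaves \<open>a0 * \<rho>\<^sup>2 * (f k - fs)\<close>
        plus the quadratic terms that \<open>q_step\<close> absorbs.\<close>
      then have "a0 * \<rho>\<^sup>2 * f (Suc k) \<le> a0 * \<rho>\<^sup>2 * (f k + quad_form M1 (e k))"
        "a0 * (1 - \<rho>\<^sup>2) * f (Suc k) \<le> a0 * (1 - \<rho>\<^sup>2) * (fs + quad_form M2 (e k))"
        using a0 rho2 by (auto intro!: mult_left_mono)
      then show ?thesis
        using q_step [of k] by (simp add: V_def algebra_simps)
    qed
    have "V k \<le> \<rho> ^ (2 * k) * V 0"
    proof (induction k)
      case (Suc k)
      have "V (Suc k) \<le> \<rho>\<^sup>2 * (\<rho> ^ (2 * k) * V 0)"
        using V_step [of k] mult_left_mono [OF Suc rho2(1)] by linarith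
      then show ?case
        by (simp add: power2_eq_square mult.assoc)
    qed simp
    \<comment> \<open>Positive semidefiniteness of \<open>P0\<close> lets the quadratic part of
      \<open>V k\<close> be discarded, so that the decay of \<open>V\<close> bounds the objective
      gap alone.\<close>
    moreover have "0 \<le> q k"
      using P0 by (simp add: q_def pos_semidef_def)
    ultimately have "a0 * (f k - fs) \<le> V 0 * \<rho> ^ (2 * k)"
      by (simp add: V_def mult.commute)
    then have "f k - fs \<le> V 0 / a0 * \<rho> ^ (2 * k)"
      using a0 by (simp add: pos_le_divide_eq mult.commute)
    then show ?thesis
      using a0 by (simp add: F_f fs V_def q_def)
  qed
qed

end
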